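(* For integers $0\le k\le n$, let $\left\langle n\atop k\right\rangle$ denote the number of $n$-tilings (tilings of a board of any length using exactly $n$ tiles, each a square or a $(1,1)$-fence) that contain exactly $k$ fences, with $\left\langle 0\atop 0\right\rangle=1$. Let $R(n,k)$ be the coefficient of $x^n$ in the power series expansion of $\dfrac{1}{1-x^2}\left(\dfrac{x}{1-x}\right)^k$ (the $(n,k)$th entry of the Riordan array $(1/(1-x^2),x/(1-x))$). Then for all $0\le k\le n$, \[ \left\langle n\atop k\right\rangle=R(n,n-k). \]
   Context: A board of length $L$ is a $1\times L$ row of unit cells. A square is a $1\times1$ tile. A $(1,1)$-fence is a tile consisting of two $1\times1$ posts separated by a one-cell gap; placed on a board its posts occupy cells $i$ and $i+2$, and the gap cell must be covered by another tile. A tiling covers every cell exactly once. *)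

theory Defs
  imports "HOL-Computational_Algebra.Formal_Power_Series"
begin

text \<open>The board of length L consists of the cells 1, ..., L. A tile is given together with its
  position: the square on cell i, or the (1,1)-fence whose posts lie on cells i and i + 2.\<close>

datatype tile = Square nat | Fence nat

fun tile_cells :: "tile \<Rightarrow> nat set" where
  "tile_cells (Square i) = {i}"
| "tile_cells (Fence i) = {i, i + 2}"

fun is_fence :: "tile \<Rightarrow> bool" where
  "is_fence (Square i) = False"
| "is_fence (Fence i) = True"

text \<open>The gap cell of a fence lies between its posts, hence on the board; so exact covering of
  the board already forces the gap to be covered, necessarily by another tile.\<close>

definition is_tiling :: "nat \<Rightarrow> tile set \<Rightarrow> bool" where
  "is_tiling L T \<longleftrightarrow>
     (\<forall>t\<in>T. tile_cells t \<subseteq> {1..L}) \<and> (\<forall>c\<in>{1..L}. \<exists>!t. t \<in> T \<and> c \<in> tile_cells t)"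

text \<open>Tilings of boards of all lengths are counted, so the length is part of the counted object.
  The set is finite: a tiling with n tiles, k of them fences, covers exactly n + k cells.\<close>

definition num_tilings :: "nat \<Rightarrow> nat \<Rightarrow> nat" where
  "num_tilings n k =
     card {(L, T). is_tiling L T \<and> card T = n \<and> card {t \<in> T. is_fence t} = k}"

definition riordan :: "'a::comm_semiring_1 fps \<Rightarrow> 'a fps \<Rightarrow> nat \<Rightarrow> nat \<Rightarrow> 'a" where
  "riordan p q n k = fps_nth (p * q ^ k) n"

definition R :: "nat \<Rightarrow> nat \<Rightarrow> rat" where
  "R = riordan (1 / (1 - fps_X ^ 2)) (fps_X / (1 - fps_X))"

end

theory Submission
  imports Defs
begin

text \<open>The last cells of a nonempty tiling are covered in exactly one of three ways: by a square,
  by a fence whose gap holds a square, or by two interlocking fences. Cutting off this last block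
  gives \<open>A(s,f) = A(s-1,f) + A(s-1,f-1) + A(s,f-2)\<close> for the number \<open>A(s,f)\<close> of tilings with \<open>s\<close>
  squares and \<open>f\<close> fences. With \<open>p = 1/(1-x\<^sup>2)\<close> and \<open>q = x/(1-x)\<close>, the identity
  \<open>(1 - x\<^sup>2) q = x + x\<^sup>2\<close> yields the same recurrence for the coefficient of
  \<open>x\<^bsup>s+f\<^esup>\<close> in \<open>p q\<^sup>s\<close>.\<close>

section \<open>Exact coverings of arbitrary cell sets\<close>

text \<open>Freeing the cell set from being an initial segment allows a board to be split into a
  shorter board and the cells of its last block.\<close>

definition tiles :: "nat set \<Rightarrow> tile set \<Rightarrow> bool" where
  "tiles C T \<longleftrightarrow>
     (\<forall>t\<in>T. tile_cells t \<subseteq> C) \<and> (\<forall>c\<in>C. \<exists>!t. t \<in> T \<and> c \<in> tile_cells t)"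

lemma is_tiling_iff_tiles: "is_tiling L T \<longleftrightarrow> tiles {1..L} T"
  by (simp add: is_tiling_def tiles_def)

lemma tile_cells_nonempty: "tile_cells t \<noteq> {}"
  by (cases t) auto

lemma tiles_empty_iff: "tiles {} T \<longleftrightarrow> T = {}"
  using tile_cells_nonempty by (auto simp: tiles_def)

lemma tiles_finite:
  assumes "tiles C T" "finite C"
  shows "finite T"
proof (rule finite_subset)
  show "T \<subseteq> Square ` C \<union> Fence ` C"
  proof
    fix t assume "t \<in> T"
    then have "tile_cells t \<subseteq> C" using assms by (auto simp: tiles_def)
    then show "t \<in> Square ` C \<union> Fence ` C" by (cases t) auto
  qed
qed (use assms in auto)

lemma tiles_Un:
  assumes "tiles C T" "tiles D B" "C \<inter> D = {}"
  shows "tiles (C \<union> D) (T \<union> B)"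
  unfolding tiles_def
proof (intro conjI ballI)
  fix t assume "t \<in> T \<union> B"
  then show "tile_cells t \<subseteq> C \<union> D" using assms unfolding tiles_def by blast
next
  fix c assume "c \<in> C \<union> D"
  then show "\<exists>!t. t \<in> T \<union> B \<and> c \<in> tile_cells t"
  proof
    assume c: "c \<in> C"
    then have "\<exists>!t. t \<in> T \<and> c \<in> tile_cells t" using assms unfolding tiles_def by blast
    moreover have "t \<notin> B" if "c \<in> tile_cells t" for t
      using that c assms unfolding tiles_def by blast
    ultimately show ?thesis by blast
  next
    assume c: "c \<in> D"
    then have "\<exists>!t. t \<in> B \<and> c \<in> tile_cells t" using assms unfolding tiles_def by blast
    moreover have "t \<notin> T" if "c \<in> tile_cells t" for t
      using that c assms unfolding tiles_def by blast
    ultimately show ?thesis by blast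
  qed
qed

text \<open>Each cell of \<open>D\<close> already lies in a tile of \<open>B\<close>, so by
  uniqueness in \<open>T\<close> no tile outside \<open>B\<close> touches \<open>D\<close>.\<close>

lemma tiles_Diff:
  assumes T: "tiles (C \<union> D) T" and B: "tiles D B" "B \<subseteq> T" and disj: "C \<inter> D = {}"
  shows "tiles C (T - B)"
  unfolding tiles_def
proof (intro conjI ballI)
  fix t assume t: "t \<in> T - B"
  have "c \<notin> D" if c: "c \<in> tile_cells t" for c
  proof
    assume "c \<in> D"
    then obtain b where "b \<in> B" "c \<in> tile_cells b" using B unfolding tiles_def by blast
    moreover have "\<exists>!t. t \<in> T \<and> c \<in> tile_cells t"
      using T \<open>c \<in> D\<close> unfolding tiles_def by blast
    ultimately show False using t c B by blast
  qed
  then show "tile_cells t \<subseteq> C" using T t unfolding tiles_def by blast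
next
  fix c assume c: "c \<in> C"
  then have "\<exists>!t. t \<in> T \<and> c \<in> tile_cells t" using T unfolding tiles_def by blast
  moreover have "t \<notin> B" if "c \<in> tile_cells t" for t
    using that c B disj unfolding tiles_def by blast
  ultimately show "\<exists>!t. t \<in> T - B \<and> c \<in> tile_cells t" by blast
qed

section \<open>Appending and removing a block at the right end\<close>

text \<open>Tiles carry absolute positions, so a block is a function of the length \<open>L\<close>
  of the board that it extends.\<close>

definition append_block :: "nat \<Rightarrow> (nat \<Rightarrow> tile set) \<Rightarrow> nat \<times> tile set \<Rightarrow> nat \<times> tile set" where
  "append_block m B = (\<lambda>(L, T). (L + m, T \<union> B L))"

definition is_block :: "nat \<Rightarrow> (nat \<Rightarrow> tile set) \<Rightarrow> bool" where
  "is_block m B \<longleftrightarrow> (\<forall>L. tiles {L + 1..L + m} (B L))"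

definition block_S :: "nat \<Rightarrow> tile set" where
  "block_S L = {Square (L + 1)}"

definition block_FS :: "nat \<Rightarrow> tile set" where
  "block_FS L = {Fence (L + 1), Square (L + 2)}"

definition block_FF :: "nat \<Rightarrow> tile set" where
  "block_FF L = {Fence (L + 1), Fence (L + 2)}"

lemma is_block_S: "is_block 1 block_S"
  by (auto simp: is_block_def block_S_def tiles_def)

lemma is_block_FS: "is_block 3 block_FS"
proof -
  have "{L + 1..L + 3} = {L + 1, L + 2, L + 3}" for L :: nat by auto
  then show ?thesis by (auto simp: is_block_def block_FS_def tiles_def)
qed

lemma is_block_FF: "is_block 4 block_FF"
proof -
  have "{L + 1..L + 4} = {L + 1, L + 2, L + 3, L + 4}" for L :: nat by auto
  then show ?thesis by (auto simp: is_block_def block_FF_def tiles_def)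
qed

lemma interval_append: "{1..L + m} = {1..L} \<union> {L + 1..L + m}" for L m :: nat
  by auto

lemma is_tiling_append:
  assumes "is_tiling L T" "is_block m B"
  shows "is_tiling (L + m) (T \<union> B L)"
  using assms unfolding is_tiling_iff_tiles is_block_def interval_append[of L m]
  by (intro tiles_Un) auto

lemma is_tiling_remove:
  assumes "is_tiling (L + m) T" "is_block m B" "B L \<subseteq> T"
  shows "is_tiling L (T - B L)"
  using assms unfolding is_tiling_iff_tiles is_block_def interval_append[of L m]
  by (intro tiles_Diff[of _ "{L + 1..L + m}"]) auto

lemma is_tiling_finite: "is_tiling L T \<Longrightarrow> finite T"
  unfolding is_tiling_iff_tiles by (erule tiles_finite) simp

lemma is_tiling_cells: "is_tiling L T \<Longrightarrow> t \<in> T \<Longrightarrow> tile_cells t \<subseteq> {1..L}"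
  by (auto simp: is_tiling_def)

text \<open>A common tile would have its cells both within the first \<open>L\<close> and beyond
  them, but every tile has a cell.\<close>

lemma is_tiling_block_disjoint:
  assumes "is_tiling L T" "is_block m B"
  shows "T \<inter> B L = {}"
proof -
  have "tile_cells t = {}" if "t \<in> T" "t \<in> B L" for t
  proof -
    have "tile_cells t \<subseteq> {1..L}" "tile_cells t \<subseteq> {L + 1..L + m}"
      using that assms is_tiling_cells unfolding is_block_def tiles_def by blast+
    then show ?thesis by fastforce
  qed
  then show ?thesis using tile_cells_nonempty by blast
qed

text \<open>The tile on cell \<open>L\<close> decides: a square is a block by itself, while a fence
  must have its right post there, and then the tile in its gap completes the block.\<close>

lemma is_tiling_last_block:
  assumes T: "is_tiling L T" and "L > 0"
  obtains L' where "L = L' + 1" "block_S L' \<subseteq> T"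
  | L' where "L = L' + 3" "block_FS L' \<subseteq> T"
  | L' where "L = L' + 4" "block_FF L' \<subseteq> T"
proof -
  have cover: "\<exists>t\<in>T. c \<in> tile_cells t" if "1 \<le> c" "c \<le> L" for c
    using T that unfolding is_tiling_def by (metis atLeastAtMost_iff)
  obtain t where t: "t \<in> T" "L \<in> tile_cells t" using cover[of L] \<open>L > 0\<close> by auto
  have tc: "tile_cells t \<subseteq> {1..L}" using is_tiling_cells[OF T t(1)] .
  show thesis
  proof (cases t)
    case (Square i)
    then show thesis using t \<open>L > 0\<close> that(1)[of "L - 1"] by (auto simp: block_S_def)
  next
    case (Fence i)
    then have i: "L = i + 2" "1 \<le> i" using t tc by auto
    obtain u where u: "u \<in> T" "i + 1 \<in> tile_cells u" using cover[of "i + 1"] i by auto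
    have uc: "tile_cells u \<subseteq> {1..L}" using is_tiling_cells[OF T u(1)] .
    show thesis
    proof (cases u)
      case (Square j)
      then show thesis using u t Fence i that(2)[of "i - 1"] by (auto simp: block_FS_def)
    next
      case (Fence j)
      \<comment> \<open>The gap holds the right post of \<open>u\<close>: a left post on
        \<open>i + 1\<close> would put the other on \<open>i + 3\<close>, which is
        \<open>L + 1\<close>.\<close>
      then have "i = j + 1" "1 \<le> j" using u uc i by auto
      then show thesis using u t Fence \<open>t = Fence i\<close> i that(3)[of "j - 1"]
        by (auto simp: block_FF_def)
    qed
  qed
qed

section \<open>Tilings by number of squares and fences\<close>

text \<open>With squares in place of all tiles as first index, each block shifts the two indices by
  its own numbers of squares and fences. The length stays in the pair because
  \<open>append_block\<close> needs it.\<close>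

definition tilings :: "nat \<Rightarrow> nat \<Rightarrow> (nat \<times> tile set) set" where
  "tilings s f = {(L, T). is_tiling L T \<and>
     card {t \<in> T. \<not> is_fence t} = s \<and> card {t \<in> T. is_fence t} = f}"

lemma num_tilings_eq_card_tilings: "num_tilings (s + f) f = card (tilings s f)"
proof -
  have "card T = card {t \<in> T. \<not> is_fence t} + card {t \<in> T. is_fence t}"
    if "is_tiling L T" for L T
  proof -
    have "T = {t \<in> T. \<not> is_fence t} \<union> {t \<in> T. is_fence t}" by auto
    then show ?thesis using is_tiling_finite[OF that]
      by (metis (no_types, lifting) card_Un_disjoint disjoint_iff finite_Un mem_Collect_eq)
  qed
  then show ?thesis unfolding num_tilings_def tilings_def
    by (intro arg_cong[where f = card]) force
qed

lemma card_filter_append: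
  assumes "is_tiling L T" "is_block m B"
  shows "card {t \<in> T \<union> B L. P t} = card {t \<in> T. P t} + card {t \<in> B L. P t}"
proof -
  have "finite (B L)" using assms(2) unfolding is_block_def by (blast intro: tiles_finite)
  moreover have "{t \<in> T \<union> B L. P t} = {t \<in> T. P t} \<union> {t \<in> B L. P t}" by auto
  ultimately show ?thesis
    using is_tiling_finite[OF assms(1)] is_tiling_block_disjoint[OF assms]
    by (auto intro: card_Un_disjoint)
qed

lemma card_block:
  "card {t \<in> block_S L. \<not> is_fence t} = 1" "card {t \<in> block_S L. is_fence t} = 0"
  "card {t \<in> block_FS L. \<not> is_fence t} = 1" "card {t \<in> block_FS L. is_fence t} = 1"
  "card {t \<in> block_FF L. \<not> is_fence t} = 0" "card {t \<in> block_FF L. is_fence t} = 2"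
proof -
  have "{t \<in> block_S L. \<not> is_fence t} = {Square (L + 1)}" "{t \<in> block_S L. is_fence t} = {}"
    "{t \<in> block_FS L. \<not> is_fence t} = {Square (L + 2)}"
    "{t \<in> block_FS L. is_fence t} = {Fence (L + 1)}"
    "{t \<in> block_FF L. \<not> is_fence t} = {}"
    "{t \<in> block_FF L. is_fence t} = {Fence (L + 1), Fence (L + 2)}"
    by (auto simp: block_S_def block_FS_def block_FF_def)
  then show
    "card {t \<in> block_S L. \<not> is_fence t} = 1" "card {t \<in> block_S L. is_fence t} = 0"
    "card {t \<in> block_FS L. \<not> is_fence t} = 1" "card {t \<in> block_FS L. is_fence t} = 1"
    "card {t \<in> block_FF L. \<not> is_fence t} = 0" "card {t \<in> block_FF L. is_fence t} = 2"
    by (simp_all only: card.empty) simp_all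
qed

lemma append_block_mem_tilings:
  assumes "is_block m B"
    and "\<And>L. card {t \<in> B L. \<not> is_fence t} = s'" "\<And>L. card {t \<in> B L. is_fence t} = f'"
    and "x \<in> tilings s f"
  shows "append_block m B x \<in> tilings (s + s') (f + f')"
proof -
  obtain L T where x: "x = (L, T)" and T: "is_tiling L T"
    "card {t \<in> T. \<not> is_fence t} = s" "card {t \<in> T. is_fence t} = f"
    using assms(4) by (auto simp: tilings_def)
  note card = card_filter_append[OF T(1) assms(1)]
  show ?thesis
    unfolding x append_block_def tilings_def prod.case mem_Collect_eq card T(2,3) assms(2,3)
    using is_tiling_append[OF T(1) assms(1)] by simp
qed

text \<open>Removing the block inverts \<open>append_block\<close>. The existential form also
  records that \<open>s\<close> and \<open>f\<close> are at least the counts of the block, which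
  avoids truncated subtraction.\<close>

lemma mem_append_block_image:
  assumes B: "is_block m B"
    and c: "\<And>L. card {t \<in> B L. \<not> is_fence t} = s'" "\<And>L. card {t \<in> B L. is_fence t} = f'"
    and T: "(L + m, T) \<in> tilings s f" "B L \<subseteq> T"
  shows "\<exists>s0 f0. s = s0 + s' \<and> f = f0 + f' \<and> (L + m, T) \<in> append_block m B ` tilings s0 f0"
proof -
  have T': "is_tiling L (T - B L)"
    using T B by (auto simp: tilings_def intro: is_tiling_remove)
  have eq: "T = (T - B L) \<union> B L" using T by auto
  have split: "card {t \<in> T. P t} = card {t \<in> T - B L. P t} + card {t \<in> B L. P t}" for P
    using card_filter_append[OF T' B, of P] unfolding eq[symmetric] .
  have "card {t \<in> T. \<not> is_fence t} = s" "card {t \<in> T. is_fence t} = f"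
    using T(1) by (simp_all add: tilings_def)
  then have "s = card {t \<in> T - B L. \<not> is_fence t} + s'" "f = card {t \<in> T - B L. is_fence t} + f'"
    using split[of "\<lambda>t. \<not> is_fence t"] split[of is_fence] unfolding c by (simp_all only:)
  moreover have "(L, T - B L) \<in> tilings (card {t \<in> T - B L. \<not> is_fence t})
      (card {t \<in> T - B L. is_fence t})"
    using T' by (simp add: tilings_def)
  moreover have "(L + m, T) = append_block m B (L, T - B L)"
    unfolding append_block_def prod.case eq[symmetric] ..
  ultimately show ?thesis by blast
qed

text \<open>Equal images have equal lengths, hence contain the same block; it is disjoint from both
  tilings and can be cancelled.\<close>

lemma inj_on_append_block:
  assumes "is_block m B"
  shows "inj_on (append_block m B) (tilings s f)"
proof (rule inj_onI, clarify)
  fix L T L' T'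
  assume T: "(L, T) \<in> tilings s f" "(L', T') \<in> tilings s f"
    and "append_block m B (L, T) = append_block m B (L', T')"
  then have eq: "L = L'" "T \<union> B L = T' \<union> B L"
    by (auto simp: append_block_def)
  moreover have "T \<inter> B L = {}" "T' \<inter> B L = {}"
    using T is_tiling_block_disjoint[OF _ assms] unfolding tilings_def eq(1) by blast+
  ultimately show "L = L' \<and> T = T'" by blast
qed

section \<open>Classification by the last block, and the recurrence for tilings\<close>

text \<open>Here and in the next two definitions the indices count the tiles before the block is
  appended.\<close>

definition S_tilings :: "nat \<Rightarrow> nat \<Rightarrow> (nat \<times> tile set) set" where
  "S_tilings s f = append_block 1 block_S ` tilings s f"

definition FS_tilings :: "nat \<Rightarrow> nat \<Rightarrow> (nat \<times> tile set) set" where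
  "FS_tilings s f = append_block 3 block_FS ` tilings s f"

definition FF_tilings :: "nat \<Rightarrow> nat \<Rightarrow> (nat \<times> tile set) set" where
  "FF_tilings s f = append_block 4 block_FF ` tilings s f"

lemmas ends_tilings_defs = S_tilings_def FS_tilings_def FF_tilings_def

lemma card_ends_tilings:
  "card (S_tilings s f) = card (tilings s f)"
  "card (FS_tilings s f) = card (tilings s f)"
  "card (FF_tilings s f) = card (tilings s f)"
  unfolding ends_tilings_defs
  \<comment> \<open>Without the deletion, \<open>1\<close> would become \<open>Suc 0\<close> and
    \<open>is_block_S\<close> would no longer match.\<close>
  by (simp_all add: card_image inj_on_append_block is_block_S is_block_FS is_block_FF
      del: One_nat_def)

lemma ends_tilings_subset:
  "S_tilings s f \<subseteq> tilings (Suc s) f"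
  "FS_tilings s f \<subseteq> tilings (Suc s) (Suc f)"
  "FF_tilings s f \<subseteq> tilings s (Suc (Suc f))"
  using append_block_mem_tilings[OF is_block_S card_block(1,2)]
    append_block_mem_tilings[OF is_block_FS card_block(3,4)]
    append_block_mem_tilings[OF is_block_FF card_block(5,6)]
  unfolding ends_tilings_defs by auto

lemma tilings_cases:
  assumes "x \<in> tilings s f"
  obtains "x = (0, {})" "s = 0" "f = 0"
  | s' where "s = Suc s'" "x \<in> S_tilings s' f"
  | s' f' where "s = Suc s'" "f = Suc f'" "x \<in> FS_tilings s' f'"
  | f' where "f = Suc (Suc f')" "x \<in> FF_tilings s f'"
proof -
  obtain L T where x: "x = (L, T)" by (cases x)
  then have T: "is_tiling L T" using assms by (simp add: tilings_def)
  show thesis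
  proof (cases "L = 0")
    case True
    then have "T = {}" using T by (simp add: is_tiling_iff_tiles tiles_empty_iff)
    then show thesis using assms x True that(1) by (auto simp: tilings_def)
  next
    case False
    then have "L > 0" by simp
    with T show thesis
    proof (cases rule: is_tiling_last_block)
      case (1 L')
      then show thesis
        using mem_append_block_image[OF is_block_S card_block(1,2), of L' T s f] assms x that(2)
        by (auto simp: S_tilings_def)
    next
      case (2 L')
      then show thesis
        using mem_append_block_image[OF is_block_FS card_block(3,4), of L' T s f] assms x that(3)
        by (auto simp: FS_tilings_def)
    next
      case (3 L')
      then show thesis
        using mem_append_block_image[OF is_block_FF card_block(5,6), of L' T s f] assms x that(4)
        by (auto simp: FF_tilings_def)
    qed
  qed
qed

text \<open>Squares on the last two cells identify the block: S has one on the last cell, FS only on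
  the cell before it, FF on neither.\<close>

lemma ends_tilings_disjoint:
  "S_tilings s f \<inter> FS_tilings s' f' = {}"
  "S_tilings s f \<inter> FF_tilings s'' f'' = {}"
  "FS_tilings s' f' \<inter> FF_tilings s'' f'' = {}"
proof -
  have S: "Square (fst x) \<in> snd x" if "x \<in> S_tilings s f" for x
    using that by (auto simp: S_tilings_def append_block_def block_S_def)
  \<comment> \<open>The shorter tiling has no square beyond its board, so only the block matters on
    these cells.\<close>
  have no: "Square i \<notin> T" if "(L, T) \<in> tilings a b" "i > L" for a b i L T
    using that is_tiling_cells[of L T "Square i"] by (auto simp: tilings_def)
  have FS: "Square (fst x) \<notin> snd x" "Square (fst x - 1) \<in> snd x" if "x \<in> FS_tilings s' f'" for x
    using that by (auto simp: FS_tilings_def append_block_def block_FS_def no)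
  have FF: "Square (fst x) \<notin> snd x" "Square (fst x - 1) \<notin> snd x" if "x \<in> FF_tilings s'' f''" for x
    using that by (auto simp: FF_tilings_def append_block_def block_FF_def no)
  show "S_tilings s f \<inter> FS_tilings s' f' = {}" using S FS by blast
  show "S_tilings s f \<inter> FF_tilings s'' f'' = {}" using S FF by blast
  show "FS_tilings s' f' \<inter> FF_tilings s'' f'' = {}" using FS FF by blast
qed

lemma tilings_0_0: "tilings 0 0 = {(0, {})}"
proof
  show "tilings 0 0 \<subseteq> {(0, {})}" by (auto elim: tilings_cases)
qed (simp add: tilings_def is_tiling_def)

text \<open>The patterns in \<open>s\<close> and \<open>f\<close> encode which blocks fit: S needs a
  square, FS a square and a fence, FF two fences.\<close>

lemma tilings_rec:
  "tilings 0 (Suc 0) = {}"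
  "tilings 0 (Suc (Suc f)) = FF_tilings 0 f"
  "tilings (Suc s) 0 = S_tilings s 0"
  "tilings (Suc s) (Suc 0) = S_tilings s (Suc 0) \<union> FS_tilings s 0"
  "tilings (Suc s) (Suc (Suc f)) =
     S_tilings s (Suc (Suc f)) \<union> FS_tilings s (Suc f) \<union> FF_tilings (Suc s) f"
proof -
  note sub = ends_tilings_subset
  \<comment> \<open>\<open>tilings_cases\<close> recast as a membership rule, so that each inclusion
    below is settled by comparing indices.\<close>
  have *: "x \<in> A" if "x \<in> tilings s f" "(s, f) = (0, 0) \<Longrightarrow> (0, {}) \<in> A"
    "\<And>s'. s = Suc s' \<Longrightarrow> S_tilings s' f \<subseteq> A"
    "\<And>s' f'. s = Suc s' \<Longrightarrow> f = Suc f' \<Longrightarrow> FS_tilings s' f' \<subseteq> A"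
    "\<And>f'. f = Suc (Suc f') \<Longrightarrow> FF_tilings s f' \<subseteq> A" for x A s f
    using that(1) by (cases rule: tilings_cases) (use that(2-) in auto)
  have "tilings 0 (Suc 0) \<subseteq> {}"
    by (rule subsetI, erule *) auto
  then show "tilings 0 (Suc 0) = {}" by simp
  show "tilings 0 (Suc (Suc f)) = FF_tilings 0 f"
    by (intro equalityI sub, rule subsetI, erule *) auto
  show "tilings (Suc s) 0 = S_tilings s 0"
    by (intro equalityI sub, rule subsetI, erule *) auto
  show "tilings (Suc s) (Suc 0) = S_tilings s (Suc 0) \<union> FS_tilings s 0"
    by (intro equalityI sub Un_least, rule subsetI, erule *) auto
  show "tilings (Suc s) (Suc (Suc f)) =
      S_tilings s (Suc (Suc f)) \<union> FS_tilings s (Suc f) \<union> FF_tilings (Suc s) f"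
    by (intro equalityI sub Un_least, rule subsetI, erule *) auto
qed

text \<open>By the recurrence, each set is a finite union of images of sets with smaller
  \<open>s + f\<close>.\<close>

lemma finite_tilings: "finite (tilings s f)"
proof (induction "s + f" arbitrary: s f rule: less_induct)
  case less
  then show ?case
    by (cases s; cases f; cases "f - 1") (auto simp: tilings_0_0 tilings_rec ends_tilings_defs)
qed

lemma finite_ends_tilings:
  "finite (S_tilings s f)" "finite (FS_tilings s f)" "finite (FF_tilings s f)"
  by (simp_all add: ends_tilings_defs finite_tilings)

lemma card_tilings:
  "card (tilings 0 0) = 1"
  "card (tilings 0 (Suc 0)) = 0"
  "card (tilings 0 (Suc (Suc f))) = card (tilings 0 f)"
  "card (tilings (Suc s) 0) = card (tilings s 0)"
  "card (tilings (Suc s) (Suc 0)) = card (tilings s (Suc 0)) + card (tilings s 0)"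
  "card (tilings (Suc s) (Suc (Suc f))) =
     card (tilings s (Suc (Suc f))) + card (tilings s (Suc f)) + card (tilings (Suc s) f)"
  by (simp_all add: tilings_0_0 tilings_rec card_Un_disjoint Int_Un_distrib2 ends_tilings_disjoint
      finite_ends_tilings card_ends_tilings)

section \<open>The recurrence for the Riordan coefficients\<close>

text \<open>The denominator has constant term 1, so it is a unit and the quotient is a true
  inverse.\<close>

lemma fps_riordan_p: "(1 - fps_X ^ 2) * (1 / (1 - fps_X ^ 2)) = (1 :: rat fps)"
  by (simp add: fps_divide_unit inverse_mult_eq_1')

lemma fps_riordan_q: "(1 - fps_X) * (fps_X / (1 - fps_X)) = (fps_X :: rat fps)"
proof -
  have "(1 - fps_X) * (fps_X * inverse (1 - fps_X)) = fps_X * ((1 - fps_X) * inverse (1 - fps_X :: rat fps))"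
    by (simp only: ac_simps)
  then show ?thesis by (simp add: fps_divide_unit inverse_mult_eq_1')
qed

text \<open>From \<open>p = 1 + fps_X ^ 2 * p\<close> the column is 1, 0, 1, 0, ..., matching the
  fact that without squares fences occur in interlocking pairs.\<close>

lemma R_0:
  "R 0 0 = 1" "R (Suc 0) 0 = 0" "R (Suc (Suc n)) 0 = R n 0"
proof -
  define p :: "rat fps" where "p = 1 / (1 - fps_X ^ 2)"
  have R: "R n 0 = fps_nth p n" for n
    by (simp add: R_def riordan_def p_def)
  have "(1 - fps_X ^ 2) * p = 1"
    unfolding p_def by (rule fps_riordan_p)
  then have "p = 1 + fps_X ^ 2 * p"
    by (simp add: algebra_simps)
  then have "fps_nth p n = fps_nth (1 + fps_X ^ 2 * p) n" for n
    by simp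
  then have "R n 0 = (if n = 0 then 1 else 0) + (if n < 2 then 0 else R (n - 2) 0)" for n
    unfolding R fps_add_nth fps_X_power_mult_nth fps_one_nth .
  from this[of 0] this[of "Suc 0"] this[of "Suc (Suc n)"]
  show "R 0 0 = 1" "R (Suc 0) 0 = 0" "R (Suc (Suc n)) 0 = R n 0" by simp_all
qed

text \<open>Multiplying \<open>q = fps_X ^ 2 * q + fps_X + fps_X ^ 2\<close> by
  \<open>p * q ^ s\<close> gives terms that match the blocks FF, S and FS: the exponent of
  \<open>fps_X\<close> counts tiles, that of \<open>q\<close> squares.\<close>

lemma R_Suc:
  "R 0 (Suc s) = 0" "R (Suc 0) (Suc s) = R 0 s"
  "R (Suc (Suc n)) (Suc s) = R n (Suc s) + R (Suc n) s + R n s"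
proof -
  define p q :: "rat fps" where "p = 1 / (1 - fps_X ^ 2)" and "q = fps_X / (1 - fps_X)"
  have R: "R n s = fps_nth (p * q ^ s) n" for n s
    by (simp add: R_def riordan_def p_def q_def)
  have "(1 - fps_X) * q = fps_X"
    unfolding q_def by (rule fps_riordan_q)
  \<comment> \<open>The factor turns \<open>1 - fps_X\<close> into \<open>1 - fps_X ^ 2\<close>,
    giving the two-step shift that FF requires.\<close>
  then have "(1 + fps_X) * ((1 - fps_X) * q) = (1 + fps_X) * fps_X"
    by simp
  \<comment> \<open>Writing \<open>fps_X ^ 1\<close> lets \<open>fps_X_power_mult_nth\<close> treat
    all three terms alike.\<close>
  then have "q = fps_X ^ 2 * q + fps_X ^ 1 + fps_X ^ 2"
    by (simp add: algebra_simps power2_eq_square)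
  then have "p * q ^ s * q = p * q ^ s * (fps_X ^ 2 * q + fps_X ^ 1 + fps_X ^ 2)"
    by (rule arg_cong)
  also have "\<dots> = fps_X ^ 2 * (p * q ^ Suc s) + fps_X ^ 1 * (p * q ^ s) + fps_X ^ 2 * (p * q ^ s)"
    by (simp add: algebra_simps)
  finally have "p * q ^ Suc s =
      fps_X ^ 2 * (p * q ^ Suc s) + fps_X ^ 1 * (p * q ^ s) + fps_X ^ 2 * (p * q ^ s)"
    unfolding power_Suc2 mult.assoc .
  then have "fps_nth (p * q ^ Suc s) n = fps_nth (fps_X ^ 2 * (p * q ^ Suc s)
      + fps_X ^ 1 * (p * q ^ s) + fps_X ^ 2 * (p * q ^ s)) n" for n
    by (rule arg_cong)
  then have "R n (Suc s) = (if n < 2 then 0 else R (n - 2) (Suc s))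
      + (if n < 1 then 0 else R (n - 1) s) + (if n < 2 then 0 else R (n - 2) s)" for n
    unfolding R fps_add_nth fps_X_power_mult_nth .
  from this[of 0] this[of "Suc 0"] this[of "Suc (Suc n)"]
  show "R 0 (Suc s) = 0" "R (Suc 0) (Suc s) = R 0 s"
    "R (Suc (Suc n)) (Suc s) = R n (Suc s) + R (Suc n) s + R n s" by simp_all
qed

text \<open>As q has no constant term, \<open>q ^ s\<close> has no term below degree
  \<open>s\<close>. This removes the summands that would stand for a negative number of
  fences.\<close>

lemma R_eq_0: "n < s \<Longrightarrow> R n s = 0"
proof (induction s arbitrary: n)
  case (Suc s)
  from Suc.prems show ?case
  \<comment> \<open>One summand of the recurrence keeps the column and lowers \<open>n\<close> by
    two; the others fall under the outer hypothesis.\<close>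
  proof (induction n rule: induct_nat_012)
    case (ge2 n)
    then show ?case using Suc.IH by (simp add: R_Suc)
  qed (simp_all add: R_Suc Suc.IH)
qed simp

section \<open>Comparison of the two recurrences\<close>

lemma card_tilings_eq_R: "of_nat (card (tilings s f)) = R (s + f) s"
proof (induction "s + f" arbitrary: s f rule: less_induct)
  case less
  consider "s = 0" "f = 0" | "s = 0" "f = Suc 0" | f' where "s = 0" "f = Suc (Suc f')"
    | s' where "s = Suc s'" "f = 0" | s' where "s = Suc s'" "f = Suc 0"
    | s' f' where "s = Suc s'" "f = Suc (Suc f')"
    by (metis not0_implies_Suc)
  then show ?case
  proof cases
    case (4 s')
    \<comment> \<open>For \<open>s' = 0\<close> the row is \<open>Suc 0\<close>, which has its own
      equation in \<open>R_Suc\<close>; otherwise two of the three summands vanish by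
      \<open>R_eq_0\<close>.\<close>
    then show ?thesis using less[of s' 0] by (cases s') (simp_all add: card_tilings R_Suc R_eq_0)
  next
    case (5 s')
    then show ?thesis using less[of s' "Suc 0"] less[of s' 0]
      by (simp add: card_tilings R_Suc R_eq_0)
  next
    case (6 s' f')
    then show ?thesis
      using less[of s' "Suc (Suc f')"] less[of s' "Suc f'"] less[of "Suc s'" f']
      by (simp add: card_tilings R_Suc)
  qed (use less[of 0] in \<open>simp_all add: card_tilings R_0\<close>)
qed

theorem theorem5p12:
  fixes n k :: nat
  assumes "k \<le> n"
  shows "of_nat (num_tilings n k) = R n (n - k)"
  using card_tilings_eq_R[of "n - k" k] num_tilings_eq_card_tilings[of "n - k" k] assms by simp

end
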